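(* Let $B\ge 2$ be an integer. (i) No deterministic online algorithm for the single-agent ski-rental problem with varying prices in the "anything goes" case can be better than $(B+1)$-competitive (i.e. none is $\gamma$-competitive for any $\gamma<B+1$). (ii) The algorithm that rents on day $1$ and buys at any price on day $2$ (i.e. $\theta_1=0$, $\theta_2=B$) is the only $(B+1)$-competitive algorithm. (iii) Consequently, the optimal online algorithm for multiagent ski rental with pessimal others' predictions and pessimal self-predictions is to pledge $0$ (i.e. rent) on day $1$ and to pledge $B$ on day $2$. It is $(B+1)$-competitive.
   Context: Competitiveness. An online algorithm $A$ is $\gamma$-competitive if there exists a constant $d$ (which may depend on $\gamma$, but not on the input $x$) such that $cost(A(x))\le\gamma\cdot cost(OPT(x))+d$ for all inputs $x$, where $OPT(x)$ is the offline optimum. Single-agent problem ("anything goes"). An agent needs a resource on days $1,\dots,T$, where $T\ge 1$ is unknown and adversarial. The prices $p_1,p_2,\dots$ are integers in $\{0,\dots,B\}$ chosen adversarially and not known in advance. An input is a pair $x=(p,T)$. A deterministic (non-adaptive) online algorithm is a sequence of integer thresholds $\theta_1,\theta_2,\ldots\in\{0,\dots,B\}$. On day $i$ (if the agent is active and has not bought yet): if $p_i\le\theta_i$ the agent buys, paying $\theta_i$ (the full threshold, even if $p_i<\theta_i$; if $p_i=0=\theta_i$ the resource is obtained for free), and pays nothing afterwards; otherwise it rents that day at cost $1$. So if $j$ is the first day with $p_j\le\theta_j$, the cost on input $(p,T)$ is $j-1+\theta_j$ if $j\le T$, and it is $T$ if there is no such $j\le T$. The offline optimum has cost $\min\bigl(T,\min_{1\le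 i\le T}(i-1+p_i)\bigr)$. Since a day with threshold $B$ always results in buying, thresholds following the first threshold equal to $B$ are never used, and algorithms differing only in such thresholds are identified. Multiagent ski rental (perspective of one agent). Each day the active agent pledges an integer amount $w_i\in\{0,\dots,B\}$ and the other agents pledge a total amount $s_i\in\{0,\dots,B\}$. If $w_i+s_i\ge B$ the group license (price $B$) is acquired, the agent pays its pledge $w_i$ (even if the license is overpledged), and the resource is free from then on; otherwise the pledges are nullified and the agent pays $1$ to rent for the day. The agent learns only whether the license was acquired. Pessimal predictions mean that both the others' pledges $s_i$ and the number $T\ge1$ of days the agent is active may be adversarial. Inputs are the pairs consisting of $(s_i)_{i\ge1}$ and $T$, and the offline optimum has cost $\min\bigl(T,\min_{1\le i\le T}(i-1+p_i)\bigr)$ with $p_i=B-s_i$.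
   Formalization: Competitiveness is taken in the strict sense, with additive constant d = 0; with an arbitrary constant d the claims (i) and (ii) fail, since any algorithm that ever uses threshold B has bounded cost and would be γ-competitive for every γ ≥ 0. *)

theory Defs
  imports Complex_Main
begin

text \<open>
  Days are numbered from 1; the value at index 0 of a price, threshold or pledge sequence is
  irrelevant. An online algorithm (a sequence of thresholds, or of pledges) is a sequence of
  integers between 0 and \<open>B\<close>. An instance is such a sequence, chosen by the adversary (prices, or
  total pledges of the others), together with the number \<open>T\<close> of active days.
\<close>

definition algorithms :: "nat \<Rightarrow> (nat \<Rightarrow> nat) set" where
  "algorithms B = {\<theta>. \<forall>i\<ge>1. \<theta> i \<le> B}"

definition instances :: "nat \<Rightarrow> ((nat \<Rightarrow> nat) \<times> nat) set" where
  "instances B = {(p, T). (\<forall>i\<ge>1. p i \<le> B) \<and> T \<ge> 1}"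

text \<open>
  Two algorithms are identified if they differ only on days that come after a common day on which
  both play \<open>B\<close> (such a day always ends the game).
\<close>

definition same_algorithm :: "nat \<Rightarrow> (nat \<Rightarrow> nat) \<Rightarrow> (nat \<Rightarrow> nat) \<Rightarrow> bool" where
  "same_algorithm B \<theta> \<theta>' \<longleftrightarrow>
     (\<forall>i\<ge>1. \<theta> i \<noteq> \<theta>' i \<longrightarrow> (\<exists>j\<in>{1..<i}. \<theta> j = B \<and> \<theta>' j = B))"

definition rent_then_buy :: "nat \<Rightarrow> nat \<Rightarrow> nat" where
  "rent_then_buy B i = (if i = 1 then 0 else B)"

definition opt_cost :: "(nat \<Rightarrow> nat) \<times> nat \<Rightarrow> nat" where
  "opt_cost = (\<lambda>(p, T). min T (Min ((\<lambda>i. i - 1 + p i) ` {1..T})))"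

definition single_cost :: "(nat \<Rightarrow> nat) \<Rightarrow> (nat \<Rightarrow> nat) \<times> nat \<Rightarrow> nat" where
  "single_cost \<theta> = (\<lambda>(p, T).
     if \<exists>j\<in>{1..T}. p j \<le> \<theta> j
     then let j = (LEAST j. 1 \<le> j \<and> p j \<le> \<theta> j) in j - 1 + \<theta> j
     else T)"

text \<open>
  In the multiagent problem the cost is accumulated day by day: nothing once the group license has
  been acquired, the pledge on the day of the acquisition, and the rent 1 before that.
\<close>

definition multi_cost :: "nat \<Rightarrow> (nat \<Rightarrow> nat) \<Rightarrow> (nat \<Rightarrow> nat) \<times> nat \<Rightarrow> nat" where
  "multi_cost B w = (\<lambda>(s, T).
     \<Sum>i = 1..T. if \<exists>j\<in>{1..<i}. w j + s j \<ge> B then 0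
                else if w i + s i \<ge> B then w i else 1)"

definition multi_opt_cost :: "nat \<Rightarrow> (nat \<Rightarrow> nat) \<times> nat \<Rightarrow> nat" where
  "multi_opt_cost B = (\<lambda>(s, T). opt_cost (\<lambda>i. B - s i, T))"

definition competitive_with ::
    "real \<Rightarrow> 'x set \<Rightarrow> ('x \<Rightarrow> nat) \<Rightarrow> ('x \<Rightarrow> nat) \<Rightarrow> real \<Rightarrow> bool" where
  "competitive_with d X cost opt \<gamma> \<longleftrightarrow> (\<forall>x\<in>X. real (cost x) \<le> \<gamma> * real (opt x) + d)"

text \<open>
  The additive constant \<open>d\<close> is taken to be 0 (strict competitiveness). For a fixed \<open>B\<close>, the cost of
  an algorithm that ever plays \<open>B\<close> is bounded, so with an arbitrary \<open>d\<close> every such algorithm would be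
  \<open>\<gamma>\<close>-competitive for all \<open>\<gamma> \<ge> 0\<close>; this is \<open>additive_constant_degenerate\<close> below.
\<close>

definition single_competitive :: "nat \<Rightarrow> (nat \<Rightarrow> nat) \<Rightarrow> real \<Rightarrow> bool" where
  "single_competitive B \<theta> \<gamma> \<longleftrightarrow>
     competitive_with 0 (instances B) (single_cost \<theta>) opt_cost \<gamma>"

definition multi_competitive :: "nat \<Rightarrow> (nat \<Rightarrow> nat) \<Rightarrow> real \<Rightarrow> bool" where
  "multi_competitive B w \<gamma> \<longleftrightarrow>
     competitive_with 0 (instances B) (multi_cost B w) (multi_opt_cost B) \<gamma>"

lemma additive_constant_degenerate:
  assumes "k \<ge> 1" and "\<theta> k = B" and "\<theta> \<in> algorithms B" and "\<gamma> \<ge> 0"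
  shows "\<exists>d. competitive_with d (instances B) (single_cost \<theta>) opt_cost \<gamma>"
proof -
  have bound: "single_cost \<theta> (p, T) \<le> k + B" if "(p, T) \<in> instances B" for p T
  proof (cases "\<exists>j\<in>{1..T}. p j \<le> \<theta> j")
    case True
    define j where "j = (LEAST j. 1 \<le> j \<and> p j \<le> \<theta> j)"
    have k: "1 \<le> k \<and> p k \<le> \<theta> k"
      using assms that by (auto simp: instances_def)
    then have "j \<le> k" and "1 \<le> j \<and> p j \<le> \<theta> j"
      unfolding j_def by (rule Least_le, rule LeastI)
    moreover from this have "\<theta> j \<le> B"
      using assms(3) by (auto simp: algorithms_def)
    moreover have "single_cost \<theta> (p, T) = j - 1 + \<theta> j"
      using True by (simp add: single_cost_def j_def Let_def)
    ultimately show ?thesis by linarith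
  next
    case False
    then have "T < k"
      using assms that by (force simp: instances_def)
    then show ?thesis
      using False by (simp add: single_cost_def)
  qed
  have "competitive_with (real (k + B)) (instances B) (single_cost \<theta>) opt_cost \<gamma>"
    unfolding competitive_with_def
  proof
    fix x assume x: "x \<in> instances B"
    have "real (single_cost \<theta> x) \<le> real (k + B)"
      using bound x by (cases x) (auto simp: of_nat_le_iff simp del: of_nat_add)
    moreover have "0 \<le> \<gamma> * real (opt_cost x)"
      using assms by simp
    ultimately show "real (single_cost \<theta> x) \<le> \<gamma> * real (opt_cost x) + real (k + B)"
      by linarith
  qed
  then show ?thesis by blast
qed

end

theory Submission
  imports Defs
begin

text \<open>
  A positive first threshold is fatal when the first price is \<open>0\<close>, since the optimum is then \<open>0\<close>.
  With first threshold \<open>0\<close>, the adversary plays the prices \<open>1, B, B, \<dots>\<close> for \<open>B + 2\<close> days: the optimum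
  is \<open>1\<close>, while the algorithm pays \<open>B + 1\<close> if its second threshold is \<open>B\<close> and at least \<open>B + 2\<close>
  otherwise. The multiagent problem is the single-agent one with prices \<open>B - s\<^sub>i\<close>.
\<close>

section \<open>Evaluating the single-agent cost and the optimum\<close>

lemma single_cost_buy:
  assumes "1 \<le> j" "j \<le> T" "p j \<le> \<theta> j" "\<And>i. 1 \<le> i \<Longrightarrow> i < j \<Longrightarrow> \<theta> i < p i"
  shows "single_cost \<theta> (p, T) = j - 1 + \<theta> j"
proof -
  have "(LEAST j. 1 \<le> j \<and> p j \<le> \<theta> j) = j"
    using assms by (intro Least_equality) (auto simp flip: not_less)
  then show ?thesis
    using assms(1-3) by (auto simp: single_cost_def Let_def)
qed

lemma single_cost_rent:
  assumes "\<And>i. 1 \<le> i \<Longrightarrow> i \<le> T \<Longrightarrow> \<theta> i < p i"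
  shows "single_cost \<theta> (p, T) = T"
  using assms by (force simp: single_cost_def)

text \<open>The two cases provide exactly the hypotheses of \<open>single_cost_buy\<close> and
  \<open>single_cost_rent\<close>, so later arguments can evaluate a cost without touching
  \<open>LEAST\<close>.\<close>

lemma first_purchase_cases:
  fixes p \<theta> :: "nat \<Rightarrow> nat"
  obtains (buy) j where "1 \<le> j" "j \<le> T" "p j \<le> \<theta> j" "\<And>i. 1 \<le> i \<Longrightarrow> i < j \<Longrightarrow> \<theta> i < p i"
    | (rent) "\<And>i. 1 \<le> i \<Longrightarrow> i \<le> T \<Longrightarrow> \<theta> i < p i"
proof (cases "\<exists>j. 1 \<le> j \<and> j \<le> T \<and> p j \<le> \<theta> j")
  case True
  then obtain j where "1 \<le> j \<and> j \<le> T \<and> p j \<le> \<theta> j"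
      and "\<forall>i<j. \<not> (1 \<le> i \<and> i \<le> T \<and> p i \<le> \<theta> i)"
    unfolding exists_least_iff[of "\<lambda>j. 1 \<le> j \<and> j \<le> T \<and> p j \<le> \<theta> j"] by blast
  then show thesis
    by (intro buy[of j]) (auto simp flip: not_less)
next
  case False
  then show thesis
    by (intro rent) (meson not_less)
qed

text \<open>Index 0 is not a day. This matters when prices are recovered from pledges, which works
  only from day 1 on.\<close>

lemma single_cost_cong:
  assumes "\<And>i. 1 \<le> i \<Longrightarrow> p i = q i"
  shows "single_cost \<theta> (p, T) = single_cost \<theta> (q, T)"
proof (cases rule: first_purchase_cases[of T p \<theta>])
  case (buy j)
  then show ?thesis
    using assms by (simp add: single_cost_buy[of j])
next
  case rent
  then show ?thesis
    using assms by (simp add: single_cost_rent)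
qed

lemma opt_cost_cong:
  assumes "\<And>i. 1 \<le> i \<Longrightarrow> p i = q i"
  shows "opt_cost (p, T) = opt_cost (q, T)"
proof -
  have "(\<lambda>i. i - 1 + p i) ` {1..T} = (\<lambda>i. i - 1 + q i) ` {1..T}"
    using assms by (intro image_cong) auto
  then show ?thesis
    by (simp add: opt_cost_def)
qed

lemma opt_cost_le_first_price:
  assumes "1 \<le> T"
  shows "opt_cost (p, T) \<le> p 1"
proof -
  have "Min ((\<lambda>i. i - 1 + p i) ` {1..T}) \<le> 1 - 1 + p 1"
    using assms by (intro Min_le imageI) auto
  then show ?thesis
    by (simp add: opt_cost_def)
qed

text \<open>Buying on day 1 costs \<open>p 1\<close>, buying later costs at least one day of rent,
  and renting throughout costs \<open>T\<close>; all three are positive.\<close>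

lemma opt_cost_pos:
  assumes "1 \<le> T" "0 < p 1"
  shows "1 \<le> opt_cost (p, T)"
proof -
  have "1 \<le> i - 1 + p i" if "1 \<le> i" for i
    using assms(2) that by (cases "i = 1") auto
  then show ?thesis
    using assms(1) by (auto simp: opt_cost_def Suc_le_eq)
qed

section \<open>Reduction of the multiagent problem to the single-agent one\<close>

text \<open>\<open>B \<le> w i + s i\<close> is the same as \<open>B - s i \<le> w i\<close>, also
  when the subtraction truncates. So the license is acquired on the day of the first purchase, and
  the daily sum collapses.\<close>

lemma multi_cost_eq_single_cost:
  "multi_cost B w (s, T) = single_cost w (\<lambda>i. B - s i, T)"
proof (cases rule: first_purchase_cases[of T "\<lambda>i. B - s i" w])
  case (buy j)
  have "multi_cost B w (s, T) = (\<Sum>i = 1..T. if i < j then 1 else if i = j then w j else 0)"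
    unfolding multi_cost_def prod.case
  proof (intro sum.cong refl)
    fix i assume i: "i \<in> {1..T}"
    show "(if \<exists>j\<in>{1..<i}. B \<le> w j + s j then 0 else if B \<le> w i + s i then w i else 1)
        = (if i < j then 1 else if i = j then w j else 0)"
    proof -
      have before: "\<not> B \<le> w k + s k" if "1 \<le> k" "k < j" for k
        using buy(4)[OF that] by linarith
      have at: "B \<le> w j + s j"
        using buy(3) by linarith
      consider "i < j" | "i = j" | "j < i" by linarith
      then show ?thesis
      proof cases
        case 1
        then show ?thesis using before i by auto
      next
        case 2
        then show ?thesis using before at by auto
      next
        case 3
        then have "\<exists>j\<in>{1..<i}. B \<le> w j + s j" using at buy(1) by auto
        with 3 show ?thesis by simp
      qed
    qed
  qed
  \<comment> \<open>The days after \<open>j\<close> contribute 0 and are dropped.\<close>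
  also have "\<dots> = (\<Sum>i \<in> {1..j}. if i < j then 1 else w j)"
    using buy(1,2) by (intro sum.mono_neutral_cong_right) auto
  also have "\<dots> = (\<Sum>i \<in> {1..<j}. 1) + w j"
  proof -
    have "{1..j} = insert j {1..<j}" using buy(1) by auto
    then show ?thesis by simp
  qed
  also have "\<dots> = single_cost w (\<lambda>i. B - s i, T)"
    using single_cost_buy[of j T "\<lambda>i. B - s i" w, OF buy] by simp
  finally show ?thesis .
next
  case rent
  have no: "\<not> B \<le> w i + s i" if "1 \<le> i" "i \<le> T" for i
    using rent[OF that] by linarith
  have "multi_cost B w (s, T) = (\<Sum>i = 1..T. 1)"
    unfolding multi_cost_def prod.case by (intro sum.cong) (auto simp: no)
  then show ?thesis
    using single_cost_rent[OF rent] by simp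
qed

lemma multi_competitive_iff_single_competitive:
  "multi_competitive B w \<gamma> \<longleftrightarrow> single_competitive B w \<gamma>"
proof
  assume multi: "multi_competitive B w \<gamma>"
  show "single_competitive B w \<gamma>"
    unfolding single_competitive_def competitive_with_def
  proof clarify
    fix p T assume inst: "(p, T) \<in> instances B"
    \<comment> \<open>The pledges that induce the prices \<open>p\<close>:
      \<open>B - (B - p i) = p i\<close> needs \<open>p i \<le> B\<close>, which is known only for
      \<open>i \<ge> 1\<close>. Hence the two congruence lemmas below.\<close>
    define s where "s i = B - p i" for i
    have prices: "B - s i = p i" if "1 \<le> i" for i
      using inst that by (auto simp: s_def instances_def)
    have "(s, T) \<in> instances B"
      using inst by (auto simp: s_def instances_def)
    with multi have "real (multi_cost B w (s, T)) \<le> \<gamma> * real (multi_opt_cost B (s, T)) + 0"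
      by (auto simp: multi_competitive_def competitive_with_def)
    moreover have "multi_cost B w (s, T) = single_cost w (p, T)"
      unfolding multi_cost_eq_single_cost by (intro single_cost_cong prices)
    moreover have "multi_opt_cost B (s, T) = opt_cost (p, T)"
      unfolding multi_opt_cost_def prod.case by (intro opt_cost_cong prices)
    ultimately show "real (single_cost w (p, T)) \<le> \<gamma> * real (opt_cost (p, T)) + 0"
      by simp
  qed
next
  assume single: "single_competitive B w \<gamma>"
  show "multi_competitive B w \<gamma>"
    unfolding multi_competitive_def competitive_with_def
  proof clarify
    fix s T assume "(s, T) \<in> instances B"
    then have "(\<lambda>i. B - s i, T) \<in> instances B"
      by (auto simp: instances_def)
    with single show "real (multi_cost B w (s, T)) \<le> \<gamma> * real (multi_opt_cost B (s, T)) + 0"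
      by (auto simp: single_competitive_def competitive_with_def multi_cost_eq_single_cost
          multi_opt_cost_def)
  qed
qed

section \<open>Lower bound and uniqueness\<close>

lemma first_threshold_zero:
  assumes "single_competitive B \<theta> \<gamma>"
  shows "\<theta> 1 = 0"
proof -
  \<comment> \<open>On this one-day instance the bound reads
    \<open>\<theta> 1 \<le> \<gamma> * 0\<close>, whatever \<open>\<gamma>\<close> is.\<close>
  have "((\<lambda>_. 0), 1) \<in> instances B"
    by (simp add: instances_def)
  with assms have "real (single_cost \<theta> (\<lambda>_. 0, 1)) \<le> \<gamma> * real (opt_cost (\<lambda>_. 0, 1))"
    by (auto simp: single_competitive_def competitive_with_def)
  moreover have "single_cost \<theta> (\<lambda>_. 0, 1) = \<theta> 1"
    using single_cost_buy[of 1 1 "\<lambda>_. 0" \<theta>] by simp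
  moreover have "opt_cost (\<lambda>_. 0, 1) = 0"
    using opt_cost_le_first_price[of 1 "\<lambda>_. 0"] by simp
  ultimately show ?thesis by simp
qed

text \<open>A first purchase on day \<open>j \<ge> 2\<close> requires threshold \<open>B\<close> and
  costs \<open>j - 1 + B\<close>: this is \<open>B + 1\<close> for \<open>j = 2\<close> and at least
  \<open>B + 2\<close> afterwards. The horizon \<open>B + 2\<close> makes renting throughout just as
  expensive as buying on day 3.\<close>

lemma adversary_cost:
  assumes "1 \<le> B" "\<theta> \<in> algorithms B" "\<theta> 1 = 0"
  defines "p \<equiv> \<lambda>i::nat. if i = 1 then 1 else B"
  shows "single_cost \<theta> (p, B + 2) \<ge> (if \<theta> 2 = B then B + 1 else B + 2)"
proof (cases rule: first_purchase_cases[of "B + 2" p \<theta>])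
  case (buy j)
  have "j \<noteq> 1"
    using buy(3) assms(3) by (auto simp: p_def)
  moreover have "\<theta> j = B"
    using buy(1,3) \<open>j \<noteq> 1\<close> assms(2) by (auto simp: p_def algorithms_def intro: antisym)
  moreover have "3 \<le> j" if "\<theta> 2 \<noteq> B"
    using that \<open>\<theta> j = B\<close> \<open>j \<noteq> 1\<close> buy(1) by (cases "j = 2") auto
  ultimately show ?thesis
    using single_cost_buy[of j "B + 2" p \<theta>, OF buy] buy(1) by auto
next
  case rent
  then show ?thesis
    using single_cost_rent[OF rent] by simp
qed

text \<open>The optimum is 1 on the adversarial instance, so the cost itself bounds
  \<open>\<gamma>\<close> from below. The gap between the two branches serves the uniqueness
  claim.\<close>

lemma single_competitive_imp:
  assumes "1 \<le> B" "\<theta> \<in> algorithms B" "single_competitive B \<theta> \<gamma>"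
  shows "(if \<theta> 2 = B then real B + 1 else real B + 2) \<le> \<gamma>"
proof -
  define p where "p = (\<lambda>i::nat. if i = 1 then 1 else B)"
  have "(p, B + 2) \<in> instances B"
    using assms(1) by (auto simp: instances_def p_def)
  with assms(3) have "real (single_cost \<theta> (p, B + 2)) \<le> \<gamma> * real (opt_cost (p, B + 2))"
    by (auto simp: single_competitive_def competitive_with_def)
  moreover have "opt_cost (p, B + 2) = 1"
    using opt_cost_le_first_price[of "B + 2" p] opt_cost_pos[of "B + 2" p] by (simp add: p_def)
  ultimately show ?thesis
    using adversary_cost[OF assms(1,2) first_threshold_zero[OF assms(3)], folded p_def]
    by (auto split: if_splits)
qed

lemma same_algorithm_rent_then_buy:
  assumes "\<theta> 1 = 0" "\<theta> 2 = B"
  shows "same_algorithm B \<theta> (rent_then_buy B)"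
  unfolding same_algorithm_def
proof (intro allI impI)
  fix i :: nat assume "1 \<le> i" "\<theta> i \<noteq> rent_then_buy B i"
  \<comment> \<open>The sequences agree on days 1 and 2, so they can differ only from day 3 on,
    after the common \<open>B\<close> on day 2.\<close>
  then have "2 \<in> {1..<i}"
    using assms by (cases "i = 1 \<or> i = 2") (auto simp: rent_then_buy_def)
  then show "\<exists>j\<in>{1..<i}. \<theta> j = B \<and> rent_then_buy B j = B"
    using assms(2) by (intro bexI[of _ 2]) (simp_all add: rent_then_buy_def)
qed

section \<open>Upper bound and conclusion\<close>

text \<open>If the first price is 0, the resource is obtained for free on day 1. Otherwise the cost
  is at most one rent plus \<open>B\<close>, while the optimum is at least 1.\<close>

lemma rent_then_buy_competitive:
  "single_competitive B (rent_then_buy B) (real B + 1)"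
  unfolding single_competitive_def competitive_with_def
proof clarify
  fix p T assume inst: "(p, T) \<in> instances B"
  then have T: "1 \<le> T" and p2: "p 2 \<le> B"
    by (auto simp: instances_def)
  have "single_cost (rent_then_buy B) (p, T) \<le> (B + 1) * opt_cost (p, T)"
  proof (cases "p 1 = 0")
    case True
    then show ?thesis
      using single_cost_buy[of 1 T p "rent_then_buy B"] T by (simp add: rent_then_buy_def)
  next
    case False
    have "single_cost (rent_then_buy B) (p, T) \<le> B + 1"
    proof (cases "T = 1")
      case True
      have "single_cost (rent_then_buy B) (p, T) = T"
        using False True by (intro single_cost_rent) (simp add: rent_then_buy_def le_antisym)
      then show ?thesis using True by simp
    next
      case False
      have "rent_then_buy B i < p i" if "1 \<le> i" "i < 2" for i
      proof -
        have "i = 1" using that by simp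
        then show ?thesis using \<open>p 1 \<noteq> 0\<close> by (simp add: rent_then_buy_def)
      qed
      \<comment> \<open>Threshold \<open>B\<close> accepts every legal price, so day 2 is the first
        purchase and the cost is \<open>1 + B\<close>.\<close>
      then show ?thesis
        using single_cost_buy[of 2 T p "rent_then_buy B"] False T p2
        by (simp add: rent_then_buy_def)
    qed
    also have "\<dots> \<le> (B + 1) * opt_cost (p, T)"
      using mult_le_mono2[OF opt_cost_pos[of T p], of "B + 1"] T False by simp
    finally show ?thesis .
  qed
  then have "real (single_cost (rent_then_buy B) (p, T)) \<le> real ((B + 1) * opt_cost (p, T))"
    by (rule of_nat_mono)
  then show "real (single_cost (rent_then_buy B) (p, T)) \<le> (real B + 1) * real (opt_cost (p, T)) + 0"
    by (simp add: algebra_simps)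
qed

theorem theorem1:
  fixes B :: nat
  assumes "B \<ge> 2"
  shows
    "(\<forall>\<theta>\<in>algorithms B. \<forall>\<gamma>::real. \<gamma> < real B + 1 \<longrightarrow> \<not> single_competitive B \<theta> \<gamma>) \<and>
     (rent_then_buy B \<in> algorithms B \<and>
      single_competitive B (rent_then_buy B) (real B + 1) \<and>
      (\<forall>\<theta>\<in>algorithms B. single_competitive B \<theta> (real B + 1) \<longrightarrow>
         same_algorithm B \<theta> (rent_then_buy B))) \<and>
     (multi_competitive B (rent_then_buy B) (real B + 1) \<and>
      (\<forall>w\<in>algorithms B. \<forall>\<gamma>::real. \<gamma> < real B + 1 \<longrightarrow> \<not> multi_competitive B w \<gamma>) \<and>
      (\<forall>w\<in>algorithms B. multi_competitive B w (real B + 1) \<longrightarrow>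
         same_algorithm B w (rent_then_buy B)))"
proof -
  have B: "1 \<le> B"
    using assms by simp
  have lower: "\<not> single_competitive B \<theta> \<gamma>" if "\<theta> \<in> algorithms B" "\<gamma> < real B + 1" for \<theta> \<gamma>
    using single_competitive_imp[OF B that(1), of \<gamma>] that(2) by (auto split: if_splits)
  have unique: "same_algorithm B \<theta> (rent_then_buy B)"
    if "\<theta> \<in> algorithms B" "single_competitive B \<theta> (real B + 1)" for \<theta>
  proof (rule same_algorithm_rent_then_buy)
    show "\<theta> 1 = 0"
      using that(2) by (rule first_threshold_zero)
    show "\<theta> 2 = B"
      \<comment> \<open>At \<open>\<gamma> = B + 1\<close> the other branch would give
        \<open>B + 2 \<le> B + 1\<close>.\<close>
      using single_competitive_imp[OF B that] by (auto split: if_splits)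
  qed
  have "rent_then_buy B \<in> algorithms B"
    by (simp add: algorithms_def rent_then_buy_def)
  then show ?thesis
    using lower unique rent_then_buy_competitive
    by (simp add: multi_competitive_iff_single_competitive)
qed

end
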